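(* Let $\mathcal{C}_1=\{1,2c_1,2c_2,2c_3,\dots\}$ be a set of positive integers consisting of $1$ together with a nonempty collection of even numbers $2c_i$ with all $c_i\geq 2$, and let $\mathcal{C}_2=\{1,2c\}$ where $c=\min\{c_1,c_2,c_3,\dots\}$. Then $\mathcal{G}_{\mathcal{C}_1}(n)=\mathcal{G}_{\mathcal{C}_2}(n)$ for all $n\geq 1$.
   Context: For a set $\mathcal{C}$ of positive integers, the nim-sequence of \textsc{cut} with cut-set $\mathcal{C}$ is defined recursively by $\mathcal{G}_{\mathcal{C}}(n)=\operatorname{mex}\{\mathcal{G}_{\mathcal{C}}(h_0)\oplus\cdots\oplus\mathcal{G}_{\mathcal{C}}(h_d): d\in\mathcal{C}, h_0,\dots,h_d\geq 1 \text{ integers}, h_0+\cdots+h_d=n\}$, with $\oplus$ bitwise XOR and mex the least nonnegative integer not in the set. *)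

theory Defs
  imports Main
begin

definition mex :: "nat set \<Rightarrow> nat" where
  "mex A = (LEAST n. n \<notin> A)"

definition xor_list :: "nat list \<Rightarrow> nat" where
  "xor_list xs = foldr Bit_Operations.xor xs 0"

(* The tuple (h_0, ..., h_d) is a list of length d + 1.  The guard 0 < d only expresses that
   cut numbers are positive; it changes nothing when C consists of positive integers, and it
   makes the recursion well-founded for every C. *)
definition cut_moves :: "nat set \<Rightarrow> nat \<Rightarrow> nat list set" where
  "cut_moves C n =
     {hs. (\<exists>d\<in>C. 0 < d \<and> length hs = d + 1) \<and> (\<forall>h\<in>set hs. 1 \<le> h) \<and> sum_list hs = n}"

lemma cut_moves_less:
  assumes hs: "hs \<in> cut_moves C n" and h: "h \<in> set hs"
  shows "h < n"
proof -
  from h obtain xs ys where eq: "hs = xs @ h # ys" by (meson split_list)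
  have "length hs \<ge> 2" using hs by (auto simp: cut_moves_def)
  then obtain k where k: "k \<in> set (xs @ ys)"
    using eq by (cases "xs @ ys") (auto simp: neq_Nil_conv)
  then have "1 \<le> k" using hs eq by (auto simp: cut_moves_def)
  moreover have "k \<le> sum_list (xs @ ys)" using k by (rule member_le_sum_list) simp
  moreover have "n = h + sum_list (xs @ ys)" using hs eq by (simp add: cut_moves_def)
  ultimately show ?thesis by linarith
qed

function cut_nim :: "nat set \<Rightarrow> nat \<Rightarrow> nat" where
  "cut_nim C n = mex ((\<lambda>hs. xor_list (map (cut_nim C) hs)) ` cut_moves C n)"
  by pat_completeness auto
termination
  by (relation "measure snd") (auto intro: cut_moves_less)

declare cut_nim.simps [simp del]

end

theory Submission
  imports Defs
begin

text \<open>The idea is to show that the nim-sequence is explicit and does not see the larger even cuts.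
  Write \<open>x = n - 1\<close>. For \<open>c \<ge> 2\<close> the sequence is arithmetic periodic in \<open>x\<close> with period \<open>12 * c\<close> and
  saltus \<open>8\<close>, and one period consists of six rows of length \<open>2 * c\<close>:
  \<open>(0 1)^c\<close>, \<open>(2 3)^c\<close>, \<open>1 4 (5 4)^(c-1)\<close>, \<open>(3 2)^c\<close>, \<open>(4 5)^c\<close>, \<open>(6 7)^c\<close>.

  Let \<open>cost c p v\<close> be the least number that has the parity of \<open>p\<close> and is a sum of \<open>x\<close>-coordinates
  whose values have XOR \<open>v\<close>. It is subadditive, and a position \<open>x\<close> of value \<open>v\<close> satisfies
  \<open>cost c x v \<le> x < cost c x v + 2 * c\<close>. A cut
  into \<open>2 * k + 1\<close> parts lowers the sum of the coordinates by \<open>2 * k\<close>, so for \<open>k \<ge> c\<close> it never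
  preserves the value. Conversely \<open>cost c p v\<close> is attained by two parts, and the surplus can be
  absorbed by two equal parts, so the cut into \<open>2 * c + 1\<close> parts reaches every \<open>v\<close> with
  \<open>cost c x v + 2 * c \<le> x\<close>. The few remaining values are reached by cuts into two parts.\<close>

section \<open>Mex and XOR on natural numbers\<close>

lemma mex_eqI:
  assumes "m \<notin> A" "\<And>w. w < m \<Longrightarrow> w \<in> A"
  shows "mex A = m"
  unfolding mex_def using assms by (intro Least_equality) (auto simp: not_less[symmetric])

lemma xor_list_simps [simp]:
  "xor_list [] = 0"
  "xor_list (v # vs) = Bit_Operations.xor v (xor_list vs)"
  by (simp_all add: xor_list_def)

lemma xor_list_append [simp]:
  "xor_list (us @ vs) = Bit_Operations.xor (xor_list us) (xor_list vs)"
  by (induction us) (simp_all add: xor.assoc)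

lemma xor_list_replicate_zero [simp]: "xor_list (replicate n 0) = 0"
  by (induction n) simp_all

text \<open>XOR is addition with the carries dropped; the induction strips the last bit of both
  numbers.\<close>

lemma xor_nat_le_add: "Bit_Operations.xor a b \<le> a + (b :: nat)"
proof (induction a arbitrary: b rule: less_induct)
  case (less a)
  show ?case
  proof (cases "a = 0")
    case False
    then have "Bit_Operations.xor (a div 2) (b div 2) \<le> a div 2 + b div 2"
      by (intro less.IH) simp
    then show ?thesis
      by (subst xor_rec) (auto simp: odd_iff_mod_2_eq_one; presburger)
  qed simp
qed

text \<open>The saltus 8 is a power of two, so XOR acts separately on the period index (quotient by
  8) and on the value inside a period (remainder).\<close>

lemma xor_div_8:
  "Bit_Operations.xor a b div 8 = Bit_Operations.xor (a div 8) (b div 8 :: nat)"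
  using drop_bit_xor[of 3 a b] by (simp add: drop_bit_eq_div)

lemma xor_mod_8:
  "Bit_Operations.xor a b mod 8 = Bit_Operations.xor (a mod 8) (b mod 8 :: nat)"
  using take_bit_xor[of 3 a b] by (simp add: take_bit_eq_mod)

lemma xor_add_8_mult:
  assumes "a < 8" "b < 8"
  shows "Bit_Operations.xor (8 * q + a) b = 8 * q + Bit_Operations.xor a (b :: nat)"
proof -
  have "Bit_Operations.xor (8 * q + a) b div 8 = q"
    "Bit_Operations.xor (8 * q + a) b mod 8 = Bit_Operations.xor a b"
    using assms by (simp_all add: xor_div_8 xor_mod_8)
  then show ?thesis by (metis mult_div_mod_eq)
qed

lemma less_8_cases:
  assumes "(s :: nat) < 8"
  obtains "s = 0" | "s = 1" | "s = 2" | "s = 3" | "s = 4" | "s = 5" | "s = 6" | "s = 7"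
  using assms by linarith

section \<open>The explicit sequence and its cost function\<close>

definition base_val :: "nat \<Rightarrow> nat \<Rightarrow> nat" where
  "base_val c r =
     (if r < 2 * c then r mod 2
      else if r < 4 * c then 2 + r mod 2
      else if r = 4 * c then 1
      else if r < 6 * c then 4 + Suc r mod 2
      else if r < 8 * c then 2 + Suc r mod 2
      else if r < 10 * c then 4 + r mod 2
      else 6 + r mod 2)"

definition cut_val :: "nat \<Rightarrow> nat \<Rightarrow> nat" where
  "cut_val c x = 8 * (x div (12 * c)) + base_val c (x mod (12 * c))"

text \<open>For \<open>c \<ge> 2\<close>, an entry is the first position in a period with parity
  \<open>p\<close> and value \<open>s\<close>. Three combinations occur at no position and are paid
  for by two: odd 0 by \<open>4*c\<close> and \<open>1\<close>, odd 6 by \<open>4*c+1\<close> and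
  \<open>2*c\<close>, even 7 by \<open>4*c+1\<close> and \<open>2*c+1\<close>.\<close>

definition base_cost :: "nat \<Rightarrow> nat \<Rightarrow> nat \<Rightarrow> nat" where
  "base_cost c p s =
     (if even p then [0, 4*c, 2*c, 6*c, 8*c, 4*c+2, 10*c, 6*c+2]
      else [4*c+1, 1, 6*c+1, 2*c+1, 4*c+1, 8*c+1, 6*c+1, 10*c+1]) ! s"

definition cost :: "nat \<Rightarrow> nat \<Rightarrow> nat \<Rightarrow> nat" where
  "cost c p v = 12 * c * (v div 8) + base_cost c p (v mod 8)"

lemma base_val_less_8: "base_val c r < 8"
  by (simp add: base_val_def mod_2_eq_odd)

lemma cut_val_div_8: "cut_val c x div 8 = x div (12 * c)"
  and cut_val_mod_8: "cut_val c x mod 8 = base_val c (x mod (12 * c))"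
  using base_val_less_8[of c "x mod (12 * c)"] by (simp_all add: cut_val_def)

lemma cut_val_add: "r < 12 * c \<Longrightarrow> cut_val c (12 * c * q + r) = 8 * q + base_val c r"
  by (simp add: cut_val_def)

lemma cut_val_base: "r < 12 * c \<Longrightarrow> cut_val c r = base_val c r"
  by (simp add: cut_val_def)

section \<open>Cost bounds and cuts into an odd number of parts\<close>

lemma base_cost_subadd:
  assumes "s < 8" "t < 8" "0 < c"
  shows "base_cost c (a + b) (Bit_Operations.xor s t) \<le> base_cost c a s + base_cost c b t"
  using assms(1)
  by (cases rule: less_8_cases; use assms(2,3) in \<open>cases rule: less_8_cases\<close>;
      cases "even a"; cases "even b"; simp add: base_cost_def)

lemma cost_subadd:
  assumes "0 < c"
  shows "cost c (a + b) (Bit_Operations.xor v w) \<le> cost c a v + cost c b w"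
proof -
  have "12 * c * (Bit_Operations.xor v w div 8) \<le> 12 * c * (v div 8 + w div 8)"
    unfolding xor_div_8 by (intro mult_le_mono2 xor_nat_le_add)
  moreover have "base_cost c (a + b) (Bit_Operations.xor v w mod 8)
      \<le> base_cost c a (v mod 8) + base_cost c b (w mod 8)"
    unfolding xor_mod_8 by (intro base_cost_subadd) (simp_all add: assms)
  ultimately show ?thesis by (simp add: cost_def add_mult_distrib2)
qed

text \<open>Inside a row, a value taken at positions of one parity starts exactly at its cost, and a
  row has length \<open>2*c\<close>.\<close>

lemma base_cost_base_val:
  assumes "0 < c" "r < 12 * c"
  shows "base_cost c r (base_val c r) \<le> r" "r < base_cost c r (base_val c r) + 2 * c"
proof -
  have "base_cost c r (base_val c r) \<le> r \<and> r < base_cost c r (base_val c r) + 2 * c"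
  proof (cases "even r")
    case True
    then obtain m where "r = 2 * m" by (rule evenE)
    then show ?thesis using assms by (simp add: base_cost_def base_val_def mod_Suc split: if_split)
  next
    case False
    then obtain m where m: "r = 2 * m + 1" by (rule oddE)
    then have "r \<noteq> 4 * c" by presburger
    with m show ?thesis using assms
      by (simp add: base_cost_def base_val_def mod_Suc split: if_split)
  qed
  then show "base_cost c r (base_val c r) \<le> r" "r < base_cost c r (base_val c r) + 2 * c"
    by simp_all
qed

lemma
  assumes "0 < c"
  shows cost_cut_val_le: "cost c x (cut_val c x) \<le> x"
    and less_cost_cut_val: "x < cost c x (cut_val c x) + 2 * c"
proof -
  define q r where "q = x div (12 * c)" and "r = x mod (12 * c)"
  have x: "x = 12 * c * q + r" and r: "r < 12 * c" using assms by (simp_all add: q_def r_def)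
  have "cost c x (cut_val c x) = 12 * c * q + base_cost c r (base_val c r)"
    by (simp add: cost_def cut_val_div_8 cut_val_mod_8 q_def[symmetric] r_def[symmetric])
      \<comment> \<open>The period \<open>12*c\<close> is even, so \<open>x\<close> and
        \<open>r\<close> have the same parity.\<close>
      (simp add: x base_cost_def)
  then show "cost c x (cut_val c x) \<le> x" "x < cost c x (cut_val c x) + 2 * c"
    using base_cost_base_val[OF assms r] by (simp_all add: x)
qed

lemma cost_sum_list_le:
  assumes "0 < c"
  shows "cost c (sum_list xs) (xor_list (map (cut_val c) xs)) \<le> sum_list xs"
proof (induction xs)
  case (Cons x xs)
  then show ?case
    using cost_subadd[OF assms, of x "sum_list xs" "cut_val c x" "xor_list (map (cut_val c) xs)"]
      cost_cut_val_le[OF assms, of x] by simp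
qed (simp add: cost_def base_cost_def)

lemma odd_cut_val_neq:
  assumes "0 < c" "c \<le> k"
  shows "xor_list (map (cut_val c) xs) \<noteq> cut_val c (sum_list xs + 2 * k)"
proof
  assume "xor_list (map (cut_val c) xs) = cut_val c (sum_list xs + 2 * k)"
  then have "cost c (sum_list xs) (cut_val c (sum_list xs + 2 * k)) \<le> sum_list xs"
    using cost_sum_list_le[OF assms(1), of xs] by simp
  \<comment> \<open>The cost sees the position only through its parity, which the shift by
    \<open>2*k\<close> keeps. But subtracting at least \<open>2*c\<close> pushes the position below
    the cost of its value.\<close>
  moreover have "cost c (sum_list xs) v = cost c (sum_list xs + 2 * k) v" for v
    by (simp add: cost_def base_cost_def)
  ultimately show False
    using less_cost_cut_val[OF assms(1), of "sum_list xs + 2 * k"] assms(2) by simp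
qed

section \<open>Cuts into two parts do not preserve the value\<close>

lemma base_val_div_2:
  "base_val c r div 2 =
     (if r < 2 * c then 0 else if r < 4 * c then 1 else if r = 4 * c then 0
      else if r < 6 * c then 2 else if r < 8 * c then 1 else if r < 10 * c then 2 else 3)"
  by (simp add: base_val_def mod_2_eq_odd)

text \<open>Rows three and four reverse the parity of the position; the isolated 1 at
  \<open>4*c\<close> fits this pattern.\<close>

lemma even_base_val:
  assumes "0 < c"
  shows "even (base_val c r) \<longleftrightarrow> (even r \<longleftrightarrow> \<not> (4 * c \<le> r \<and> r < 8 * c))"
  using assms by (simp add: base_val_def mod_2_eq_odd)

lemma base_two_part_neq:
  assumes "0 < c" "x + y + 1 < 12 * c"
  shows "Bit_Operations.xor (base_val c x) (base_val c y) \<noteq> base_val c (x + y + 1)"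
proof
  assume eq: "Bit_Operations.xor (base_val c x) (base_val c y) = base_val c (x + y + 1)"
  define H where "H r = base_val c r div 2" for r
  have half: "Bit_Operations.xor (H x) (H y) = H (x + y + 1)"
    using drop_bit_xor[of 1 "base_val c x" "base_val c y"] eq
    by (simp add: H_def drop_bit_eq_div)
  have par: "even (base_val c (x + y + 1)) \<longleftrightarrow> (even (base_val c x) \<longleftrightarrow> even (base_val c y))"
    using eq[symmetric] by (simp add: even_xor_iff)
  \<comment> \<open>Half-value 2 at the total forces \<open>x < 6*c\<close> and
    \<open>y < 2*c\<close>; half-value 3 forces \<open>x < 6*c\<close> and \<open>y < 4*c\<close>.
    Either way the total falls short of the row it should lie in.\<close>
  have mixed: False
    if bds: "4 * c \<le> x" "x < 8 * c" "y < 4 * c" "8 * c \<le> x + y + 1"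
      and half: "Bit_Operations.xor (H x) (H y) = H (x + y + 1)" for x y
  proof -
    have "x = 4 * c \<and> H x = 0
        \<or> 4 * c < x \<and> x < 6 * c \<and> H x = 2
        \<or> 6 * c \<le> x \<and> H x = 1"
      using bds(1,2) assms(1) by (simp add: H_def base_val_div_2)
    moreover have "y < 2 * c \<and> H y = 0 \<or> 2 * c \<le> y \<and> H y = 1"
      using bds(3) by (simp add: H_def base_val_div_2)
    moreover have "8 * c \<le> x + y + 1 \<and> x + y + 1 < 10 * c \<and> H (x + y + 1) = 2
        \<or> 10 * c \<le> x + y + 1 \<and> H (x + y + 1) = 3"
      using bds(4) assms(1) unfolding H_def base_val_div_2 by simp
    ultimately show False using half[symmetric] bds by (elim disjE conjE) simp_all
  qed
  define D where "D r \<longleftrightarrow> 4 * c \<le> r \<and> r < 8 * c" for r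
  \<comment> \<open>The extra 1 makes the number of reversed positions among \<open>x\<close>,
    \<open>y\<close> and \<open>x + y + 1\<close> odd. Three is impossible because
    \<open>4*c + 4*c + 1\<close> exceeds \<open>8*c\<close>, so there is exactly one.\<close>
  have "D (x + y + 1) \<longleftrightarrow> (D x \<longleftrightarrow> D y)"
    using par unfolding even_base_val[OF assms(1)] D_def[symmetric] by auto
  moreover have "\<not> (D x \<and> D y \<and> D (x + y + 1))" unfolding D_def by linarith
  ultimately consider "\<not> D x" "\<not> D y" "D (x + y + 1)"
    | "D x" "\<not> D y" "\<not> D (x + y + 1)" | "\<not> D x" "D y" "\<not> D (x + y + 1)"
    by blast
  then show False
  proof cases
    case 1
    \<comment> \<open>The parts have half-values 0 or 1, which rules out 2. Half-value 0 at
      \<open>4*c\<close> needs both parts in one row, whose totals miss \<open>4*c\<close>;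
      half-value 1 in row four needs different rows, whose totals stay below
      \<open>6*c\<close>.\<close>
    then have bds: "x < 4 * c" "y < 4 * c" "4 * c \<le> x + y + 1" "x + y + 1 < 8 * c"
      by (auto simp: D_def)
    have "x < 2 * c \<and> H x = 0 \<or> 2 * c \<le> x \<and> H x = 1"
      using bds(1) by (simp add: H_def base_val_div_2)
    moreover have "y < 2 * c \<and> H y = 0 \<or> 2 * c \<le> y \<and> H y = 1"
      using bds(2) by (simp add: H_def base_val_div_2)
    moreover have "x + y + 1 \<le> 4 * c \<and> H (x + y + 1) = 0
        \<or> 4 * c < x + y + 1 \<and> x + y + 1 < 6 * c \<and> H (x + y + 1) = 2
        \<or> 6 * c \<le> x + y + 1 \<and> H (x + y + 1) = 1"
      using bds(3,4) unfolding H_def base_val_div_2 by simp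
    ultimately show False using half[symmetric] bds by (elim disjE conjE) simp_all
  next
    case 2
    then have "4 * c \<le> x" "x < 8 * c" "y < 4 * c" "8 * c \<le> x + y + 1"
      using assms(2) by (auto simp: D_def)
    then show False using half by (rule mixed)
  next
    case 3
    then have "4 * c \<le> y" "y < 8 * c" "x < 4 * c" "8 * c \<le> y + x + 1"
      using assms(2) by (auto simp: D_def)
    then show False
      using half by (intro mixed[of y x]) (simp_all add: xor.commute add.commute)
  qed
qed

lemma two_part_neq:
  assumes "0 < c"
  shows "Bit_Operations.xor (cut_val c x) (cut_val c y) \<noteq> cut_val c (x + y + 1)"
proof
  assume eq: "Bit_Operations.xor (cut_val c x) (cut_val c y) = cut_val c (x + y + 1)"
  let ?m = "12 * c"
  define p q r where "p = x div ?m" and "q = y div ?m" and "r = (x + y + 1) div ?m"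
  define a b d where "a = x mod ?m" and "b = y mod ?m" and "d = (x + y + 1) mod ?m"
  have x: "x = ?m * p + a" and y: "y = ?m * q + b" and z: "x + y + 1 = ?m * r + d"
    unfolding p_def q_def r_def a_def b_def d_def by (simp_all only: mult_div_mod_eq)
  have d: "d < ?m" using assms by (simp add: d_def)
  have "r = Bit_Operations.xor p q"
    using arg_cong[OF eq, of "\<lambda>v. v div 8"]
    by (simp only: xor_div_8 cut_val_div_8 p_def q_def r_def)
  \<comment> \<open>Equality of the quotients excludes a carry into the next period, so the residues
    add exactly and the one-period case applies.\<close>
  then have "r \<le> p + q" by (simp add: xor_nat_le_add)
  moreover have "?m * (p + q) < ?m * Suc r"
    using x y z d by (simp only: add_mult_distrib2 mult_Suc_right)
  then have "p + q < Suc r" by (simp only: mult_less_cancel1)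
  ultimately have "r = p + q" by simp
  then have "d = a + b + 1" using x y z by (simp only: add_mult_distrib2)
  moreover have "Bit_Operations.xor (base_val c a) (base_val c b) = base_val c d"
    using arg_cong[OF eq, of "\<lambda>v. v mod 8"]
    by (simp only: xor_mod_8 cut_val_mod_8 a_def b_def d_def)
  ultimately show False using base_two_part_neq[OF assms, of a b] d by simp
qed

section \<open>Reaching every smaller value\<close>

lemma cost_attained:
  assumes "2 \<le> c"
  shows "\<exists>x y. x + y = cost c p v \<and> Bit_Operations.xor (cut_val c x) (cut_val c y) = v"
proof -
  have "v mod 8 < 8" by simp
  then have "\<exists>x y. x < 12 * c \<and> y < 12 * c \<and> x + y = base_cost c p (v mod 8) \<and>
      Bit_Operations.xor (base_val c x) (base_val c y) = v mod 8"
  proof (cases rule: less_8_cases)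
    case 1 then show ?thesis using assms
      by (intro exI[of _ "if even p then 0 else 4 * c"] exI[of _ "if even p then 0 else 1"])
        (simp add: base_cost_def base_val_def mod_Suc)
  next
    case 2 then show ?thesis using assms
      by (intro exI[of _ "if even p then 4 * c else 1"] exI[of _ 0])
        (simp add: base_cost_def base_val_def mod_Suc)
  next
    case 3 then show ?thesis using assms
      by (intro exI[of _ "if even p then 2 * c else 6 * c + 1"] exI[of _ 0])
        (simp add: base_cost_def base_val_def mod_Suc)
  next
    case 4 then show ?thesis using assms
      by (intro exI[of _ "if even p then 6 * c else 2 * c + 1"] exI[of _ 0])
        (simp add: base_cost_def base_val_def mod_Suc)
  next
    case 5 then show ?thesis using assms
      by (intro exI[of _ "if even p then 8 * c else 4 * c + 1"] exI[of _ 0])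
        (simp add: base_cost_def base_val_def mod_Suc)
  next
    \<comment> \<open>Here \<open>c \<ge> 2\<close> matters: it keeps \<open>4*c + 2\<close> inside
      row three, where the value is 5.\<close>
    case 6 then show ?thesis using assms
      by (intro exI[of _ "if even p then 4 * c + 2 else 8 * c + 1"] exI[of _ 0])
        (simp add: base_cost_def base_val_def mod_Suc)
  next
    case 7 then show ?thesis using assms
      by (intro exI[of _ "if even p then 10 * c else 4 * c + 1"]
            exI[of _ "if even p then 0 else 2 * c"])
        (simp add: base_cost_def base_val_def mod_Suc)
  next
    case 8 then show ?thesis using assms
      by (intro exI[of _ "if even p then 4 * c + 1 else 10 * c + 1"]
            exI[of _ "if even p then 2 * c + 1 else 0"])
        (simp add: base_cost_def base_val_def mod_Suc)
  qed
  then obtain x y where xy: "x < 12 * c" "y < 12 * c" "x + y = base_cost c p (v mod 8)"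
    "Bit_Operations.xor (base_val c x) (base_val c y) = v mod 8" by blast
  \<comment> \<open>All full periods go to the first coordinate, so the second stays below 8 in
    value and the XOR leaves the multiple of 8 intact.\<close>
  then have "12 * c * (v div 8) + x + y = cost c p v" by (simp add: cost_def)
  moreover have "Bit_Operations.xor (cut_val c (12 * c * (v div 8) + x)) (cut_val c y) = v"
    using xy by (simp add: cut_val_add cut_val_base xor_add_8_mult base_val_less_8)
  ultimately show ?thesis by blast
qed

lemma even_cost_iff: "even (cost c p v) \<longleftrightarrow> even p"
proof -
  have "even (base_cost c p s) \<longleftrightarrow> even p" if "s < 8" for s
    using that by (cases rule: less_8_cases) (simp_all add: base_cost_def)
  then show ?thesis by (simp add: cost_def)
qed

lemma odd_cut_reaches:
  assumes "2 \<le> c" "cost c y v + 2 * c \<le> y"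
  shows "\<exists>xs. length xs = 2 * c + 1 \<and> sum_list xs + 2 * c = y \<and>
    xor_list (map (cut_val c) xs) = v"
proof -
  obtain a b where ab: "a + b = cost c y v"
    "Bit_Operations.xor (cut_val c a) (cut_val c b) = v"
    using cost_attained[OF assms(1)] by blast
  have "even (y - (cost c y v + 2 * c))"
    using assms(2) even_cost_iff[of c y v] by simp
  then obtain t where "y - (cost c y v + 2 * c) = 2 * t" by (rule evenE)
  then have t: "y = cost c y v + 2 * c + 2 * t" using assms(2) by linarith
  have "cut_val c 0 = 0" using assms(1) by (simp add: cut_val_def base_val_def)
  with ab t assms(1) show ?thesis
    \<comment> \<open>The two copies of \<open>t\<close> absorb the even surplus and cancel in the
      XOR; zero coordinates have value 0. The four leading entries fit because
      \<open>2*c + 1 \<ge> 4\<close>.\<close>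
    by (intro exI[of _ "[a, b, t, t] @ replicate (2 * c - 3) 0"])
      (simp add: sum_list_replicate xor.assoc[symmetric])
qed

text \<open>The last hypothesis leaves only values too expensive for the cut into
  \<open>2*c + 1\<close> parts. They are obtained from neighbours \<open>0\<close> and
  \<open>r - 1\<close>, from the end of an earlier row (\<open>2*c - 1\<close> or
  \<open>4*c - 1\<close>) paired with \<open>j\<close>, or from two positions of row two.\<close>

lemma base_two_part_reaches:
  assumes "2 \<le> c" "r < 12 * c" "s < base_val c r" "r < base_cost c r s + 2 * c"
  shows "\<exists>x y. x + y + 1 = r \<and> Bit_Operations.xor (base_val c x) (base_val c y) = s"
proof -
  have s8: "s < 8" using assms(3) base_val_less_8[of c r] by linarith
  consider "r < 2 * c" | "2 * c \<le> r" "r < 4 * c" | "4 * c \<le> r" "r < 6 * c" | "6 * c \<le> r"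
    by linarith
  then show ?thesis
  proof cases
    case 1
    then have "odd r" "s = 0" using assms(3)
      by (auto simp: base_val_def odd_iff_mod_2_eq_one)
    with 1 show ?thesis
      by (intro exI[of _ 0] exI[of _ "r - 1"]) (auto simp: base_val_def elim!: oddE)
  next
    case 2
    define j where "j = r - 2 * c"
    have r: "r = 2 * c + j" and j: "j < 2 * c" using 2 by (simp_all add: j_def)
    have last: "base_val c (2 * c - 1) = 1"
      using assms(1) by (simp add: base_val_def mod_2_eq_odd)
    have row0: "base_val c j = j mod 2" using j by (simp add: base_val_def)
    have val: "base_val c r = 2 + j mod 2" using 2 by (simp add: base_val_def r)
    show ?thesis
    proof (cases "even j")
      case True
      have "s = 1"
        using s8 True assms(3,4) val by (cases rule: less_8_cases) (auto simp: base_cost_def r)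
      with True show ?thesis using assms(1) row0 last
        by (intro exI[of _ "2 * c - 1"] exI[of _ j]) (simp add: r)
    next
      case False
      have "s = 0 \<or> s = 2"
        using s8 assms(3,4) val False odd_pos[OF False]
        by (cases rule: less_8_cases) (auto simp: base_cost_def r odd_iff_mod_2_eq_one)
      then show ?thesis
      proof
        assume "s = 0"
        with False show ?thesis using assms(1) row0 last
          by (intro exI[of _ "2 * c - 1"] exI[of _ j]) (simp add: r odd_iff_mod_2_eq_one)
      next
        assume "s = 2"
        with False show ?thesis using assms(1) j
          by (intro exI[of _ 0] exI[of _ "r - 1"]) (auto simp: r base_val_def elim!: oddE)
      qed
    qed
  next
    case 3
    define j where "j = r - 4 * c"
    have r: "r = 4 * c + j" and j: "j < 2 * c" using 3 by (simp_all add: j_def)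
    have last: "base_val c (4 * c - 1) = 3"
      using assms(1) by (simp add: base_val_def mod_2_eq_odd)
    have row0: "base_val c j = j mod 2" using j by (simp add: base_val_def)
    have row1: "base_val c (2 * c) = 2"
      "0 < j \<Longrightarrow> base_val c (2 * c + j - 1) = 2 + (j - 1) mod 2"
      using assms(1) j by (simp add: base_val_def, cases j) (simp_all add: base_val_def mod_2_eq_odd)
    have val: "base_val c r = (if j = 0 then 1 else 4 + Suc j mod 2)"
      using 3 by (simp add: base_val_def r mod_2_eq_odd)
    show ?thesis
    proof (cases "even j")
      case True
      have s: "j \<noteq> 0" "s = 1 \<or> s = 3 \<or> s = 4"
        using s8 True assms(3,4) val
        by (cases rule: less_8_cases; auto simp: base_cost_def r mod_Suc split: if_splits)+
      from s(2) show ?thesis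
      proof (elim disjE)
        assume "s = 1"
        with True s(1) show ?thesis using row1
          by (intro exI[of _ "2 * c"] exI[of _ "2 * c + j - 1"]) (auto simp: r mod_2_eq_odd)
      next
        assume "s = 3"
        with True show ?thesis using assms(1) row0 last
          by (intro exI[of _ "4 * c - 1"] exI[of _ j]) (simp add: r)
      next
        assume "s = 4"
        with True s(1) show ?thesis using assms(1) j
          by (intro exI[of _ 0] exI[of _ "r - 1"])
            (auto simp: r base_val_def mod_2_eq_odd)
      qed
    next
      case False
      have s: "j \<noteq> 0" "s = 0 \<or> s = 2"
        using s8 False assms(3,4) val odd_pos[OF False]
        by (cases rule: less_8_cases;
            auto simp: base_cost_def r mod_Suc odd_iff_mod_2_eq_one split: if_splits)+
      from s(2) show ?thesis
      proof
        assume "s = 0"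
        with False s(1) show ?thesis using row1
          by (intro exI[of _ "2 * c"] exI[of _ "2 * c + j - 1"]) (auto simp: r mod_2_eq_odd)
      next
        assume "s = 2"
        with False show ?thesis using assms(1) row0 last
          by (intro exI[of _ "4 * c - 1"] exI[of _ j]) (simp add: r odd_iff_mod_2_eq_one)
      qed
    qed
  next
    case 4
    then have val: "base_val c r =
        (if even r then if r < 8 * c then 3 else if r < 10 * c then 4 else 6
         else if r < 8 * c then 2 else if r < 10 * c then 5 else 7)"
      using assms(1) by (simp add: base_val_def mod_2_eq_odd)
    \<comment> \<open>From row four on, every smaller value is cheap enough for the long cut, so the
      hypotheses conflict. An odd \<open>r\<close> is never a row start, which pays for the extra 1
      in the odd costs.\<close>
    have "odd r \<Longrightarrow> r \<noteq> 6 * c \<and> r \<noteq> 8 * c \<and> r \<noteq> 10 * c" by auto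
    then have "base_cost c r s + 2 * c \<le> r"
      using val 4 assms(1,3)
      by (cases rule: less_8_cases[OF s8]; cases "even r"; simp add: base_cost_def split: if_splits)
    then show ?thesis using assms(4) by simp
  qed
qed

lemma reachable:
  assumes "2 \<le> c" "v < cut_val c y"
  shows "\<exists>xs. (length xs = 2 \<or> length xs = 2 * c + 1) \<and> sum_list xs + length xs = y + 1 \<and>
    xor_list (map (cut_val c) xs) = v"
proof (cases "cost c y v + 2 * c \<le> y")
  case True
  then obtain xs where "length xs = 2 * c + 1" "sum_list xs + 2 * c = y"
    "xor_list (map (cut_val c) xs) = v"
    using odd_cut_reaches[OF assms(1)] by blast
  then show ?thesis by (intro exI[of _ xs]) simp
next
  case False
  define q r where "q = y div (12 * c)" and "r = y mod (12 * c)"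
  have y: "y = 12 * c * q + r" and r: "r < 12 * c"
    using assms(1) by (simp_all add: q_def r_def)
  have cost: "cost c y v = 12 * c * (v div 8) + base_cost c r (v mod 8)"
    by (simp add: cost_def base_cost_def y)
  have "v div 8 \<le> q"
    using div_le_mono[OF less_imp_le[OF assms(2)], of 8] by (simp add: cut_val_div_8 q_def)
  moreover have "\<not> v div 8 < q"
  proof
    assume "v div 8 < q"
    then have "12 * c * Suc (v div 8) \<le> 12 * c * q" by (intro mult_le_mono2) simp
    \<comment> \<open>No entry exceeds \<open>10*c\<close>, or \<open>10*c + 1\<close> for odd
      \<open>r \<ge> 1\<close>; hence a value from an earlier period is always affordable for the
      long cut.\<close>
    moreover have "base_cost c r s + 2 * c \<le> 12 * c + r" if "s < 8" for s
      using that assms(1)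
      by (cases rule: less_8_cases; cases "even r"; auto simp: base_cost_def elim!: oddE)
    then have "base_cost c r (v mod 8) + 2 * c \<le> 12 * c + r" by simp
    ultimately show False using False cost by (simp add: y)
  qed
  ultimately have v: "v div 8 = q" "v = 8 * q + v mod 8" by auto
  have "v mod 8 < base_val c r"
    using assms(2) v by (simp add: y cut_val_add[OF r])
  moreover have "r < base_cost c r (v mod 8) + 2 * c"
    using False cost v by (simp add: y)
  ultimately obtain a b where ab: "a + b + 1 = r"
    "Bit_Operations.xor (base_val c a) (base_val c b) = v mod 8"
    using base_two_part_reaches[OF assms(1) r] by blast
  have "Bit_Operations.xor (cut_val c (12 * c * q + a)) (cut_val c b) = v"
    using ab r v(2)
    by (simp add: cut_val_add cut_val_base xor_add_8_mult base_val_less_8)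
  with ab y show ?thesis by (intro exI[of _ "[12 * c * q + a, b]"]) simp
qed

lemma cut_nim_eq_cut_val:
  assumes c: "2 \<le> c" and sub: "{1, 2 * c} \<subseteq> C"
    and C: "\<And>d. d \<in> C \<Longrightarrow> d \<noteq> 1 \<Longrightarrow> \<exists>k\<ge>c. d = 2 * k"
    and "1 \<le> n"
  shows "cut_nim C n = cut_val c (n - 1)"
  using \<open>1 \<le> n\<close>
proof (induction n rule: less_induct)
  case (less n)
  \<comment> \<open>Passage to coordinates; parts are at least 1, so the truncated subtraction loses
    nothing.\<close>
  have IH: "map (cut_nim C) hs = map (cut_val c) (map (\<lambda>h. h - 1) hs)"
    if "hs \<in> cut_moves C n" for hs
    using that less.IH cut_moves_less[OF that] by (auto simp: cut_moves_def)
  show ?case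
  proof (subst cut_nim.simps, rule mex_eqI)
    show "cut_val c (n - 1) \<notin> (\<lambda>hs. xor_list (map (cut_nim C) hs)) ` cut_moves C n"
    proof
      assume "cut_val c (n - 1) \<in> (\<lambda>hs. xor_list (map (cut_nim C) hs)) ` cut_moves C n"
      then obtain hs where hs: "hs \<in> cut_moves C n"
        and eq: "cut_val c (n - 1) = xor_list (map (cut_nim C) hs)" by blast
      define xs where "xs = map (\<lambda>h. h - 1) hs"
      have "hs = map Suc xs"
        using hs by (auto simp: xs_def cut_moves_def intro!: map_idI[symmetric])
      moreover have "sum_list (map Suc xs) = sum_list xs + length xs" by (induction xs) simp_all
      \<comment> \<open>With \<open>d + 1\<close> parts the coordinates sum to
        \<open>n - 1 - d\<close>: a drop of 1 for \<open>d = 1\<close> and of \<open>2*k\<close> for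
        \<open>d = 2*k\<close>.\<close>
      ultimately have sum: "n = sum_list xs + length xs" using hs by (simp add: cut_moves_def)
      have xor: "xor_list (map (cut_val c) xs) = cut_val c (n - 1)"
        using eq IH[OF hs] by (simp add: xs_def)
      obtain d where d: "d \<in> C" "length xs = d + 1"
        using hs by (auto simp: cut_moves_def xs_def)
      show False
      proof (cases "d = 1")
        case True
        then obtain x y where "xs = [x, y]" using d(2) by (auto simp: length_Suc_conv)
        then show False using two_part_neq[of c x y] xor sum c by simp
      next
        case False
        then obtain k where "k \<ge> c" "d = 2 * k" using C d(1) by blast
        then show False using odd_cut_val_neq[of c k xs] xor sum c d(2) by simp
      qed
    qed
  next
    fix v assume "v < cut_val c (n - 1)"
    then obtain xs where xs: "length xs = 2 \<or> length xs = 2 * c + 1"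
      "sum_list xs + length xs = n - 1 + 1" "xor_list (map (cut_val c) xs) = v"
      using reachable[OF c] by blast
    have "sum_list (map Suc xs) = sum_list xs + length xs" by (induction xs) simp_all
    moreover have "\<exists>d\<in>C. 0 < d \<and> length xs = d + 1" using xs(1) sub c by auto
    ultimately have mv: "map Suc xs \<in> cut_moves C n"
      using xs(2) less.prems by (auto simp: cut_moves_def)
    moreover have "xor_list (map (cut_nim C) (map Suc xs)) = v"
      unfolding IH[OF mv] using xs(3) by (simp add: comp_def)
    ultimately show "v \<in> (\<lambda>hs. xor_list (map (cut_nim C) hs)) ` cut_moves C n" by blast
  qed
qed

theorem theorem3:
  fixes K C1 C2 :: "nat set" and c n :: nat
  assumes "K \<noteq> {}"
    and "\<forall>k\<in>K. 2 \<le> k"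
    and "C1 = {1} \<union> {2 * k | k. k \<in> K}"
    and "c = (LEAST k. k \<in> K)"
    and "C2 = {1, 2 * c}"
    and "1 \<le> n"
  shows "cut_nim C1 n = cut_nim C2 n"
proof -
  have "c \<in> K" using assms(1,4) by (metis LeastI ex_in_conv)
  moreover have "\<And>k. k \<in> K \<Longrightarrow> c \<le> k" using assms(4) by (simp add: Least_le)
  ultimately have "cut_nim C1 n = cut_val c (n - 1)"
    using assms by (intro cut_nim_eq_cut_val) auto
  moreover have "cut_nim C2 n = cut_val c (n - 1)"
    using assms \<open>c \<in> K\<close> by (intro cut_nim_eq_cut_val) auto
  ultimately show ?thesis by simp
qed

end
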